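(* Let $k\ge1$, $r\ge1$ be integers, $p\in(0,1)$, $q=1-p$. For integers $g\ge1$ and $s\ge0$ let $\tilde F_{(s)}(g)=\mathbb{E}[W_g(W_g-1)\cdots(W_g-s+1)]$ be the $s$-th factorial moment of a random variable $W_g$ with the Type II negative binomial distribution $\mathrm{NB}_{\rm II}(k,g,r)$ of order $k$ with gap $g$. Then for $g=1$, $$\tilde F_{(s)}(1)=\frac{s!}{q^{s+1}p^{ks}}\sum_{j=0}^{s}(-1)^jq^jp^{jk}\binom{s-j+r-1}{r-1}\left[\binom{(k+1)s-jk}{j}-p\binom{(k+1)s-jk-1}{j}\right],$$ and for $g>1$, with $c=(r-1)(g-1)$ and $c_{(j)}=c(c-1)\cdots(c-j+1)$, $$\tilde F_{(s)}(g)=\sum_{j=0}^{\min(s,(r-1)(g-1))}\binom{s}{j}c_{(j)}\,\tilde F_{(s-j)}(1).$$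
   Context: Here $\binom{a}{b}=a(a-1)\cdots(a-b+1)/b!$ for integers $a$ and $b\ge0$ (so $\binom{a}{0}=1$ for all $a$). Consider an infinite sequence of independent trials, each $S$ (success) with probability $p$ or $F$ (failure) with probability $q=1-p$. The success runs (of order $k$ with gap $g$) are defined inductively: the first success run is the first maximal run of at least $k$ consecutive successes; if the $j$-th success run terminates at trial $m$ (i.e. $m$ is its last success and trial $m+1$ is a failure), then the $(j+1)$-th success run is the first run of at least $k$ consecutive successes which begins later than trial $m+g$, taken maximal among runs beginning later than trial $m+g$. The distribution $\mathrm{NB}_{\rm II}(k,g,r)$ is the distribution of the number of trials needed until the $r$-th success run first attains length $k$, i.e. of the index of the $k$-th success trial of the $r$-th success run. *)

theory Defs
  imports "HOL-Probability.Probability"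
begin

text \<open>Trials are numbered from 1, as usual; \<open>x i\<close> says that trial \<open>i\<close> is a success.
  An interval \<open>{a..b}\<close> of trials is represented by its end points.\<close>

definition success_interval :: "(nat \<Rightarrow> bool) \<Rightarrow> nat \<Rightarrow> nat \<Rightarrow> nat \<Rightarrow> bool" where
  "success_interval x n a b \<longleftrightarrow> n < a \<and> a \<le> b \<and> (\<forall>i\<in>{a..b}. x i)"

text \<open>Maximality is only among the success intervals that begin later than trial \<open>n\<close>;
  trial \<open>n\<close> itself may be a success.\<close>

definition maximal_run :: "(nat \<Rightarrow> bool) \<Rightarrow> nat \<Rightarrow> nat \<Rightarrow> nat \<Rightarrow> bool" where
  "maximal_run x n a b \<longleftrightarrow> success_interval x n a b \<and>
     (\<forall>a' b'. success_interval x n a' b' \<and> {a..b} \<subseteq> {a'..b'} \<longrightarrow> {a'..b'} = {a..b})"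

definition first_run :: "nat \<Rightarrow> (nat \<Rightarrow> bool) \<Rightarrow> nat \<Rightarrow> nat \<Rightarrow> nat \<Rightarrow> bool" where
  "first_run k x n a b \<longleftrightarrow> maximal_run x n a b \<and> k \<le> card {a..b} \<and>
     (\<forall>a' b'. maximal_run x n a' b' \<and> k \<le> card {a'..b'} \<longrightarrow> a \<le> a')"

text \<open>\<open>success_run k g x j a b\<close>: the \<open>j\<close>-th success run of order \<open>k\<close> with gap \<open>g\<close>
  consists of the trials \<open>a, \<dots>, b\<close>.\<close>

inductive success_run :: "nat \<Rightarrow> nat \<Rightarrow> (nat \<Rightarrow> bool) \<Rightarrow> nat \<Rightarrow> nat \<Rightarrow> nat \<Rightarrow> bool"
  for k g :: nat and x :: "nat \<Rightarrow> bool" where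
  first: "first_run k x 0 a b \<Longrightarrow> success_run k g x 1 a b"
| later: "success_run k g x j a m \<Longrightarrow> first_run k x (m + g) a' b' \<Longrightarrow>
            success_run k g x (Suc j) a' b'"

text \<open>The \<open>k\<close>-th success of a run that begins at trial \<open>a\<close> is trial \<open>a + k - 1\<close>.
  If there is no \<open>r\<close>-th (terminating) success run, which has probability 0 for
  \<open>0 < p < 1\<close>, the value is 0 by convention.\<close>

definition waiting_time :: "nat \<Rightarrow> nat \<Rightarrow> nat \<Rightarrow> (nat \<Rightarrow> bool) \<Rightarrow> nat" where
  "waiting_time k g r x =
     (if \<exists>a b. success_run k g x r a b
      then (THE n. \<exists>a b. success_run k g x r a b \<and> n = a + k - 1)
      else 0)"

definition bernoulli_trials :: "real \<Rightarrow> bool stream measure" where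
  "bernoulli_trials p = stream_space (measure_pmf (bernoulli_pmf p))"

text \<open>Streams are indexed from 0, hence the shift.\<close>

definition NB_II :: "nat \<Rightarrow> nat \<Rightarrow> nat \<Rightarrow> real \<Rightarrow> nat measure" where
  "NB_II k g r p =
     distr (bernoulli_trials p) (count_space UNIV)
       (\<lambda>\<omega>. waiting_time k g r (\<lambda>i. \<omega> !! (i - 1)))"

definition falling_factorial :: "real \<Rightarrow> nat \<Rightarrow> real" where
  "falling_factorial x s = (\<Prod>i<s. x - real i)"

definition factorial_moment :: "'a measure \<Rightarrow> ('a \<Rightarrow> nat) \<Rightarrow> nat \<Rightarrow> real" where
  "factorial_moment M W s = (\<integral>\<omega>. falling_factorial (real (W \<omega>)) s \<partial>M)"

end

theory Submission
  imports Defs "HOL-Computational_Algebra.Formal_Power_Series"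
begin

text \<open>Track the trials by a finite automaton. Let \<open>\<Phi>\<close> be the formal power series in \<open>X\<close> of the
  binomial moments of the hitting time of its target, i.e. the probability generating function at
  \<open>z = 1 + X\<close>. First-step analysis gives a linear system for these series, whose solution is
  \<open>(P - X)^r \<Phi> = (P z^(g-1))^(r-1) (p z)^k (1 - p z)\<close> with \<open>P = q p^k z^(k+1)\<close>. Expanding
  \<open>(1 - X/P)^(-r)\<close> yields the formula for \<open>g = 1\<close>, and the extra factor \<open>z^((r-1)(g-1))\<close> is the
  Vandermonde convolution for \<open>g > 1\<close>.\<close>

text \<open>Expanding at z = 1 rather than z = 0 makes the coefficients themselves the wanted
  moments, so no generating function is ever differentiated. The price is that all moments must be
  finite before the series can be manipulated, which is the purpose of the geometric bound on
  \<open>hit_prob\<close>. That the target is reached almost surely then comes for free from the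
  constant coefficient. The denominator P - X arises as 1 - p z - q z (1 - (p z)^k), because p z + q
  z = z = 1 + X. Its constant coefficient q p^k is nonzero, so it can be cancelled. The failure that
  closes a run is itself the first of the g skipped trials, hence g - 1 in the exponent. On single
  paths the obstacle is that the waiting time ends at the k-th success, whereas a success run is
  defined only through its later end. The two are reconciled on the almost sure event of infinitely
  many failures.\<close>

unbundle no vec_syntax
unbundle fps_syntax

text \<open>A state \<open>(i, c)\<close> means that \<open>i\<close> further runs are required after the one being sought.
  For \<open>c < G\<close>, where \<open>G = g - 1\<close>, a run has ended with a failure and \<open>c\<close> of the \<open>G\<close>
  trials skipped after that failure have passed; for \<open>G \<le> c < G + k\<close>
  the last \<open>c - G\<close> trials form the current streak, and for \<open>c = G + k\<close> a success run is in
  progress. The target is \<open>(0, G + k)\<close>; the start is \<open>(r - 1, G)\<close>.\<close>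

definition run_step :: "nat \<Rightarrow> nat \<Rightarrow> nat \<times> nat \<Rightarrow> bool \<Rightarrow> nat \<times> nat" where
  "run_step k G st b = (case st of (i, c) \<Rightarrow>
     if c < G then (i, Suc c)
     else if c < G + k then (if b then (i, Suc c) else (i, G))
     else (if b then (i, c) else (i - 1, 0)))"

primrec hit_prob :: "nat \<Rightarrow> nat \<Rightarrow> real \<Rightarrow> nat \<Rightarrow> nat \<times> nat \<Rightarrow> real" where
  "hit_prob k G p 0 st = of_bool (st = (0, G + k))"
| "hit_prob k G p (Suc n) st = (if st = (0, G + k) then 0
     else p * hit_prob k G p n (run_step k G st True) +
          (1 - p) * hit_prob k G p n (run_step k G st False))"

text \<open>The factor \<open>1 + X\<close> on these series accounts for one elapsed trial, by Pascal's rule.\<close>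

definition binomial_moment :: "nat \<Rightarrow> nat \<Rightarrow> real \<Rightarrow> nat \<times> nat \<Rightarrow> real fps" where
  "binomial_moment k G p st = Abs_fps (\<lambda>s. \<Sum>n. hit_prob k G p n st * real (n choose s))"

section \<open>Geometric decay of the hitting probabilities and finiteness of the moments\<close>

lemma summable_power_mult_geometric:
  fixes x :: real
  assumes "\<bar>x\<bar> < 1"
  shows "summable (\<lambda>n. real n ^ s * x ^ n)"
  using assms
proof (induction s arbitrary: x)
  case 0
  then show ?case by (simp add: summable_geometric)
next
  case (Suc s)
  \<comment> \<open>Differentiating and multiplying by \<open>x\<close> raises the power of
    \<open>n\<close> by one. Termwise differentiation needs convergence on the whole disc, hence the
    induction over arbitrary \<open>x\<close>.\<close>
  have "summable (\<lambda>n. diffs (\<lambda>n. real n ^ s) n * x ^ n)"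
    by (rule termdiff_converges[where K = 1]) (use Suc in auto)
  then have "summable (\<lambda>n. (diffs (\<lambda>n. real n ^ s) n * x ^ n) * x)"
    by (rule summable_mult2)
  then have "summable (\<lambda>n. real (Suc n) ^ Suc s * x ^ Suc n)"
    by (simp add: diffs_def algebra_simps)
  then show ?case by (subst (asm) summable_Suc_iff)
qed

lemma hit_prob_nonneg:
  assumes "0 \<le> p" "p \<le> 1"
  shows "0 \<le> hit_prob k G p n st"
  using assms by (induction n arbitrary: st) auto

text \<open>Foster-Lyapunov: \<open>V = 1 + h\<close>, where \<open>h\<close> bounds the expected remaining number of trials;
  \<open>((1/p)^k - (1/p)^d) / (1 - p)\<close> is the expected time to complete a streak of current length \<open>d\<close>.\<close>

lemma hit_prob_geometric:
  assumes p: "0 < p" "p < 1"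
  shows "\<exists>C \<rho>. 0 \<le> \<rho> \<and> \<rho> < 1 \<and>
    (\<forall>n. \<forall>i\<le>R. \<forall>c\<le>G + k. hit_prob k G p n (i, c) \<le> C * \<rho> ^ n)"
proof -
  \<comment> \<open>Truncated subtraction lets one formula serve both phases: \<open>c - G\<close>
    is 0 during the gap and \<open>G - c\<close> is 0 after it.\<close>
  define e :: "nat \<Rightarrow> real" where
    "e c = real (G - c) + ((1/p) ^ k - (1/p) ^ (c - G)) / (1 - p)" for c
  \<comment> \<open>The mean cost of one further run: \<open>1 / (1 - p)\<close> trials up to and
    including the failure that ends the run in progress, then \<open>e 0\<close> for the gap and a
    fresh streak.\<close>
  define B where "B = 1 / (1 - p) + e 0"
  define V where "V st = (case st of (i, c) \<Rightarrow> 1 + real i * B + e c)" for st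
  have e_nonneg: "0 \<le> e c" if "c \<le> G + k" for c
  proof -
    have "(1/p) ^ (c - G) \<le> (1/p) ^ k"
      using that p by (intro power_increasing) auto
    then show ?thesis using p by (simp add: e_def)
  qed
  have e_mono: "e c \<le> e 0" for c
  proof -
    have "(1/p) ^ 0 \<le> (1/p) ^ (c - G)"
      using p by (intro power_increasing) auto
    then show ?thesis using p by (auto simp: e_def intro!: add_mono divide_right_mono)
  qed
  have B: "0 \<le> B" using e_nonneg[of 0] p by (simp add: B_def)
  have V_ge: "1 \<le> V (i, c)" if "c \<le> G + k" for i c
    using that B e_nonneg by (simp add: V_def)
  define H where "H = real R * B + e 0"
  have H: "0 \<le> H" using B e_nonneg[of 0] by (simp add: H_def)
  have V_le: "V (i, c) \<le> 1 + H" if "i \<le> R" for i c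
    using that B e_mono[of c] mult_right_mono[of "real i" "real R" B] by (simp add: V_def H_def)
  \<comment> \<open>Boundedness of \<open>V\<close> on the states with \<open>i \<le> R\<close>,
    which \<open>run_step\<close> does not leave, turns the additive drift -1 into a contraction:
    \<open>V - 1 \<le> \<rho> * V\<close> is equivalent to \<open>V \<le> 1 + H\<close>.\<close>
  define \<rho> where "\<rho> = H / (1 + H)"
  have \<rho>: "0 \<le> \<rho>" "\<rho> < 1" using H by (auto simp: \<rho>_def)
  have drift: "p * V (run_step k G (i, c) True) + (1 - p) * V (run_step k G (i, c) False)
      \<le> V (i, c) - 1" if c: "c \<le> G + k" and nf: "(i, c) \<noteq> (0, G + k)" for i c
  proof -
    consider "c < G" | "G \<le> c" "c < G + k" | "c = G + k" using c by linarith
    then show ?thesis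
    proof cases
      case 1
      then have "e (Suc c) = e c - 1" by (simp add: e_def of_nat_diff)
      with 1 show ?thesis by (simp add: V_def run_step_def algebra_simps)
    next
      case 2
      then have eS: "Suc c - G = Suc (c - G)" by simp
      have "p * e (Suc c) + (1 - p) * e G = e c - 1"
        using 2 p unfolding e_def eS by (simp add: divide_simps) (simp add: algebra_simps)
      with 2 show ?thesis by (simp add: V_def run_step_def algebra_simps)
    next
      case 3
      then obtain i' where i': "i = Suc i'" using nf by (cases i) auto
      have "(1 - p) * B = 1 + (1 - p) * e 0" using p by (simp add: B_def field_simps)
      moreover have "e (G + k) = 0" by (simp add: e_def)
      ultimately show ?thesis using 3 i' by (simp add: V_def run_step_def algebra_simps)
    qed
  qed
  have drift': "p * V (run_step k G (i, c) True) + (1 - p) * V (run_step k G (i, c) False)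
      \<le> \<rho> * V (i, c)" if "i \<le> R" "c \<le> G + k" "(i, c) \<noteq> (0, G + k)" for i c
  proof -
    have "V (i, c) - 1 \<le> \<rho> * V (i, c)"
      using V_le[OF that(1), of c] H by (simp add: \<rho>_def field_simps)
    with drift[OF that(2,3)] show ?thesis by linarith
  qed
  have step: "\<exists>i' c'. run_step k G (i, c) b = (i', c') \<and> i' \<le> R \<and> c' \<le> G + k"
    if "i \<le> R" "c \<le> G + k" for i c b
    using that by (auto simp: run_step_def)
  have main: "hit_prob k G p n (i, c) \<le> V (i, c) * \<rho> ^ n" if "i \<le> R" "c \<le> G + k" for n i c
    using that
  proof (induction n arbitrary: i c)
    case 0
    then show ?case using order_trans[OF _ V_ge[of c i], of "of_bool ((i, c) = (0, G + k))"] by simp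
  next
    case (Suc n)
    show ?case
    proof (cases "(i, c) = (0, G + k)")
      case True
      then have "hit_prob k G p (Suc n) (i, c) = 0" by simp
      moreover have "0 \<le> V (i, c) * \<rho> ^ Suc n" using V_ge[of c i] Suc.prems \<rho> by (intro mult_nonneg_nonneg) auto
      ultimately show ?thesis by linarith
    next
      case False
      have le: "hit_prob k G p n (run_step k G (i, c) b) \<le> V (run_step k G (i, c) b) * \<rho> ^ n" for b
      proof -
        obtain i' c' where "run_step k G (i, c) b = (i', c')" "i' \<le> R" "c' \<le> G + k"
          using step[OF Suc.prems, of b] by blast
        then show ?thesis using Suc.IH[of i' c'] by simp
      qed
      have "hit_prob k G p (Suc n) (i, c) \<le>
          p * (V (run_step k G (i, c) True) * \<rho> ^ n) +
          (1 - p) * (V (run_step k G (i, c) False) * \<rho> ^ n)"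
        using False p by (auto intro!: add_mono mult_left_mono le)
      also have "\<dots> = (p * V (run_step k G (i, c) True) + (1 - p) * V (run_step k G (i, c) False)) * \<rho> ^ n"
        by (simp add: algebra_simps)
      also have "\<dots> \<le> (\<rho> * V (i, c)) * \<rho> ^ n"
        using drift'[OF Suc.prems False] \<rho> by (intro mult_right_mono) auto
      finally show ?thesis by (simp add: mult_ac)
    qed
  qed
  have "hit_prob k G p n (i, c) \<le> (1 + H) * \<rho> ^ n" if "i \<le> R" "c \<le> G + k" for n i c
    using main[OF that, of n] mult_right_mono[OF V_le[OF that(1), of c], of "\<rho> ^ n"] \<rho> by simp
  with \<rho> show ?thesis by blast
qed

lemma summable_hit_prob_power:
  assumes p: "0 < p" "p < 1" and c: "c \<le> G + k"
  shows "summable (\<lambda>n. hit_prob k G p n (i, c) * real n ^ s)"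
proof -
  obtain C \<rho> where C: "0 \<le> \<rho> \<and> \<rho> < 1 \<and>
      (\<forall>n. \<forall>j\<le>i. \<forall>c\<le>G + k. hit_prob k G p n (j, c) \<le> C * \<rho> ^ n)"
    using hit_prob_geometric[OF p, of i G k] by (elim exE)
  then have \<rho>: "0 \<le> \<rho>" "\<rho> < 1" by auto
  have le: "hit_prob k G p n (i, c) \<le> C * \<rho> ^ n" for n
    using C c by blast
  have "summable (\<lambda>n. C * (real n ^ s * \<rho> ^ n))"
    using \<rho> by (intro summable_mult summable_power_mult_geometric) auto
  then show ?thesis
  proof (rule summable_comparison_test'[where N = 0])
    fix n
    have "hit_prob k G p n (i, c) * real n ^ s \<le> (C * \<rho> ^ n) * real n ^ s"
      by (intro mult_right_mono le) auto
    then show "norm (hit_prob k G p n (i, c) * real n ^ s) \<le> C * (real n ^ s * \<rho> ^ n)"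
      using hit_prob_nonneg[of p k G n "(i, c)"] p by (simp add: mult_ac)
  qed
qed

lemma summable_hit_prob_binomial:
  assumes p: "0 < p" "p < 1" and c: "c \<le> G + k"
  shows "summable (\<lambda>n. hit_prob k G p n (i, c) * real (n choose s))"
proof (rule summable_comparison_test'[OF summable_hit_prob_power[OF assms, of i s], of 0])
  fix n
  have "n choose s \<le> n ^ s"
    by (cases "s \<le> n") (auto simp: binomial_le_pow binomial_eq_0)
  then have "real (n choose s) \<le> real n ^ s" by (metis of_nat_le_iff of_nat_power)
  then show "norm (hit_prob k G p n (i, c) * real (n choose s)) \<le> hit_prob k G p n (i, c) * real n ^ s"
    using hit_prob_nonneg[of p k G n "(i, c)"] p by (simp add: mult_left_mono)
qed

section \<open>First-step equations for the binomial moments\<close>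

lemma binomial_moment_final: "binomial_moment k G p (0, G + k) = 1"
proof (rule fps_ext)
  fix s
  have "(\<lambda>n. hit_prob k G p n (0, G + k) * real (n choose s)) sums
      (\<Sum>n\<in>{0}. hit_prob k G p n (0, G + k) * real (n choose s))"
  proof (rule sums_finite)
    fix n :: nat assume "n \<notin> {0}"
    then obtain m where "n = Suc m" by (cases n) auto
    then show "hit_prob k G p n (0, G + k) * real (n choose s) = 0" by simp
  qed simp
  then show "binomial_moment k G p (0, G + k) $ s = 1 $ s"
    by (cases s) (simp_all add: binomial_moment_def sums_iff)
qed

lemma binomial_moment_step:
  assumes p: "0 < p" "p < 1" and c: "c \<le> G + k" and nf: "(i, c) \<noteq> (0, G + k)"
  shows "binomial_moment k G p (i, c) = (1 + fps_X) *
    (fps_const p * binomial_moment k G p (run_step k G (i, c) True) +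
     fps_const (1 - p) * binomial_moment k G p (run_step k G (i, c) False))"
proof (rule fps_ext)
  fix s
  define Q where "Q = fps_const p * binomial_moment k G p (run_step k G (i, c) True) +
     fps_const (1 - p) * binomial_moment k G p (run_step k G (i, c) False)"
  define f where "f b n = hit_prob k G p n (run_step k G (i, c) b)" for b n
  obtain i' c' where run: "run_step k G (i, c) b = (i' b, c' b)" "c' b \<le> G + k" for b
  proof (rule that)
    show "run_step k G (i, c) b = (fst (run_step k G (i, c) b), snd (run_step k G (i, c) b))"
      "snd (run_step k G (i, c) b) \<le> G + k" for b
      using c by (auto simp: run_step_def)
  qed
  have sm: "summable (\<lambda>n. f b n * real (n choose s))" for b s
    unfolding f_def run by (intro summable_hit_prob_binomial p run)
  have mom: "(\<Sum>n. f b n * real (n choose s)) = binomial_moment k G p (run_step k G (i, c) b) $ s"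
    for b s by (simp add: f_def binomial_moment_def)
  define g where "g s n = p * (f True n * real (n choose s)) + (1 - p) * (f False n * real (n choose s))" for s n
  have g: "g s sums (Q $ s)" for s
    unfolding g_def Q_def fps_add_nth fps_mult_left_const_nth mom[symmetric]
    by (intro sums_add sums_mult summable_sums sm)
  define h where "h n = hit_prob k G p n (i, c) * real (n choose s)" for n
  \<comment> \<open>Away from the target nothing is hit at time 0, so the sum may start at
    \<open>Suc n\<close>.\<close>
  have h0: "h 0 = 0" using nf by (simp add: h_def)
  have hS: "h (Suc n) = g s n + (if s = 0 then 0 else g (s - 1) n)" for n
  proof -
    have "hit_prob k G p (Suc n) (i, c) = p * f True n + (1 - p) * f False n"
      by (simp only: hit_prob.simps f_def nf if_False)
    note * = this
    show ?thesis unfolding h_def g_def * by (cases s) (simp_all add: algebra_simps)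
  qed
  have "(\<lambda>n. h (Suc n)) sums (((1 + fps_X) * Q) $ s)"
    unfolding hS distrib_right mult_1_left fps_add_nth[of _ "fps_X * _"] fps_X_mult_nth
    by (intro sums_add g) (auto intro: g)
  then have "h sums (((1 + fps_X) * Q) $ s)"
    using h0 by (subst (asm) sums_Suc_iff) simp
  then show "binomial_moment k G p (i, c) $ s = ((1 + fps_X) * (fps_const p * binomial_moment k G p (run_step k G (i, c) True) +
     fps_const (1 - p) * binomial_moment k G p (run_step k G (i, c) False))) $ s"
    unfolding Q_def[symmetric]
    by (simp add: sums_iff h_def[abs_def] binomial_moment_def)
qed

subsection \<open>Solving the linear system for the binomial moments\<close>

text \<open>During the gap both outcomes lead to the same state, so each trial contributes only its
  factor \<open>1 + fps_X\<close>; \<open>1 \<le> k\<close> keeps these states off the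
  target.\<close>

lemma binomial_moment_gap:
  assumes p: "0 < p" "p < 1" and k: "1 \<le> k" and c: "c \<le> G"
  shows "binomial_moment k G p (i, 0) = (1 + fps_X) ^ c * binomial_moment k G p (i, c)"
  using c
proof (induction c)
  case (Suc c)
  have "binomial_moment k G p (i, c) = (1 + fps_X) * ((fps_const p + fps_const (1 - p)) *
      binomial_moment k G p (i, Suc c))"
    unfolding distrib_right[of "fps_const p" "fps_const (1 - p)"]
    using Suc.prems k by (subst binomial_moment_step[OF p]) (auto simp: run_step_def)
  also have "fps_const p + fps_const (1 - p) = 1" by simp
  finally show ?case using Suc by (simp add: mult_ac)
qed simp

text \<open>Each streak state either advances with weight \<open>y\<close> or falls back to
  \<open>(i, G)\<close> with weight \<open>z\<close>. Iterating yields the geometric sum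
  \<open>z * (1 + y + ... + y ^ (c - 1))\<close>, which the factor \<open>1 - y\<close>
  clears.\<close>

lemma binomial_moment_streak:
  fixes p :: real
  assumes p: "0 < p" "p < 1" and c: "c \<le> k"
  defines "y \<equiv> fps_const p * (1 + fps_X)" and "z \<equiv> fps_const (1 - p) * (1 + fps_X)"
  shows "binomial_moment k G p (i, G) * (1 - y - z * (1 - y ^ c)) =
    y ^ c * (1 - y) * binomial_moment k G p (i, G + c)"
  using c
proof (induction c)
  case (Suc c)
  have "binomial_moment k G p (i, G + c) =
      y * binomial_moment k G p (i, G + Suc c) + z * binomial_moment k G p (i, G)"
    using Suc.prems by (subst binomial_moment_step[OF p])
      (auto simp: run_step_def y_def z_def algebra_simps)
  with Suc show ?case by (simp add: algebra_simps)
qed simp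

text \<open>Successes leave the state unchanged, so the run lasts a geometric time; the closing
  failure and the \<open>G\<close> skipped trials make the exponent \<open>Suc G\<close>.\<close>

lemma binomial_moment_run:
  fixes p :: real
  assumes p: "0 < p" "p < 1" and k: "1 \<le> k"
  shows "(1 - fps_const p * (1 + fps_X)) * binomial_moment k G p (Suc i, G + k) =
    fps_const (1 - p) * (1 + fps_X) ^ Suc G * binomial_moment k G p (i, G)"
proof -
  have "binomial_moment k G p (Suc i, G + k) = (1 + fps_X) *
      (fps_const p * binomial_moment k G p (Suc i, G + k) +
       fps_const (1 - p) * binomial_moment k G p (i, 0))"
    by (subst binomial_moment_step[OF p]) (auto simp: run_step_def)
  then show ?thesis
    unfolding binomial_moment_gap[OF p k order_refl] by (simp add: algebra_simps)
qed

text \<open>The factor \<open>1 - y\<close> gained while completing a streak cancels against the one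
  from waiting for its closing failure. Only the last run, which is left as soon as it reaches
  length \<open>k\<close>, retains it.\<close>

lemma binomial_moment_equation:
  fixes p :: real
  assumes p: "0 < p" "p < 1" and k: "1 \<le> k"
  defines "P \<equiv> fps_const ((1 - p) * p ^ k) * (1 + fps_X) ^ Suc k"
  shows "(P - fps_X) ^ Suc i * binomial_moment k G p (i, G) = (P * (1 + fps_X) ^ G) ^ i *
    (fps_const p * (1 + fps_X)) ^ k * (1 - fps_const p * (1 + fps_X))"
proof -
  define y where "y = fps_const p * (1 + fps_X)"
  define z where "z = fps_const (1 - p) * (1 + fps_X)"
  have yz: "y + z = 1 + fps_X"
    by (simp add: y_def z_def flip: distrib_right fps_const_add)
  have P: "P = z * y ^ k"
    by (simp add: P_def y_def z_def power_mult_distrib fps_const_power mult_ac flip: fps_const_mult)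
  have "1 - y - z * (1 - y ^ k) = 1 - (y + z) + P" by (simp add: P algebra_simps)
  then have den: "1 - y - z * (1 - y ^ k) = P - fps_X" by (simp add: yz)
  have streak: "(P - fps_X) * binomial_moment k G p (i, G) =
      y ^ k * (1 - y) * binomial_moment k G p (i, G + k)" for i
    using binomial_moment_streak[OF p order_refl, of k G i] den by (simp add: y_def z_def mult.commute)
  show ?thesis
    unfolding y_def[symmetric]
  proof (induction i)
    case 0
    show ?case using streak[of 0] by (simp add: binomial_moment_final)
  next
    case (Suc i)
    have "(P - fps_X) * binomial_moment k G p (Suc i, G) =
        y ^ k * (z * (1 + fps_X) ^ G * binomial_moment k G p (i, G))"
      using streak[of "Suc i"] binomial_moment_run[OF p k, of G i]
      by (simp add: y_def z_def mult_ac)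
    also have "\<dots> = P * (1 + fps_X) ^ G * binomial_moment k G p (i, G)"
      by (simp add: P mult_ac)
    finally have "(P - fps_X) ^ Suc (Suc i) * binomial_moment k G p (Suc i, G) =
        P * (1 + fps_X) ^ G * ((P - fps_X) ^ Suc i * binomial_moment k G p (i, G))"
      by (simp add: mult_ac)
    then show ?case by (simp only: Suc) (simp add: mult_ac)
  qed
qed

section \<open>Effect of the gap and extraction of coefficients\<close>

text \<open>In probabilistic terms, widening the gap by \<open>G\<close> only adds the constant
  \<open>G * i\<close> to the waiting time in law. Formally, the two equations differ by this power
  alone, and \<open>D\<close> can be cancelled.\<close>

lemma binomial_moment_shift:
  assumes p: "0 < p" "p < 1" and k: "1 \<le> k"
  shows "binomial_moment k G p (i, G) = (1 + fps_X) ^ (G * i) * binomial_moment k 0 p (i, 0)"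
proof -
  define D where "D = fps_const ((1 - p) * p ^ k) * (1 + fps_X) ^ Suc k - (fps_X :: real fps)"
  have "D $ 0 \<noteq> 0" using p by (simp add: D_def fps_nth_power_0)
  then have D: "D ^ Suc i \<noteq> 0" by auto
  have "D ^ Suc i * binomial_moment k G p (i, G) =
      D ^ Suc i * ((1 + fps_X) ^ (G * i) * binomial_moment k 0 p (i, 0))"
    using binomial_moment_equation[OF p k, of i G] binomial_moment_equation[OF p k, of i 0]
    unfolding D_def[symmetric]
    by (simp add: mult_ac power_mult_distrib flip: power_mult) 
  with D show ?thesis by (metis mult_left_cancel)
qed

text \<open>Multiplication by \<open>1 - fps_X\<close> takes differences of coefficients, which
  lowers \<open>i\<close> by Pascal's rule.\<close>

lemma negative_binomial_fps:
  "(1 - fps_X) ^ Suc i * Abs_fps (\<lambda>n. real (n + i choose i)) = 1"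
proof (induction i)
  case 0
  show ?case by (rule fps_ext) (simp add: left_diff_distrib)
next
  case (Suc i)
  have "(1 - fps_X) * Abs_fps (\<lambda>n. real (n + Suc i choose Suc i)) = Abs_fps (\<lambda>n. real (n + i choose i))"
  proof (rule fps_ext)
    fix n
    show "((1 - fps_X) * Abs_fps (\<lambda>n. real (n + Suc i choose Suc i))) $ n =
        Abs_fps (\<lambda>n. real (n + i choose i)) $ n"
      by (cases n) (simp_all add: left_diff_distrib)
  qed
  moreover have "(1 - fps_X) ^ Suc (Suc i) * A = (1 - fps_X) ^ Suc i * ((1 - fps_X) * A)" for A :: "real fps"
    by (simp only: power_Suc mult_ac)
  ultimately show ?case using Suc by (simp only:)
qed

lemma binomial_moment_closed_form:
  fixes p :: real
  assumes p: "0 < p" "p < 1" and k: "1 \<le> k"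
  shows "binomial_moment k 0 p (i, 0) $ s =
    (\<Sum>n\<le>s. real (n + i choose i) / ((1 - p) * ((1 - p) * p ^ k) ^ n) *
      ((fps_binomial (- real (Suc k * n + 1)) - fps_const p * fps_binomial (- real (Suc k * n))) $ (s - n)))"
proof -
  define a where "a = (1 - p) * p ^ k"
  \<comment> \<open>\<open>fps_binomial a\<close> is the series of \<open>(1 + X)^a\<close>, so
    \<open>Q\<close> is the inverse of \<open>P\<close>.\<close>
  define Q where "Q = fps_const (1 / a) * fps_binomial (- real (Suc k))"
  define P where "P = fps_const a * (1 + fps_X) ^ Suc k"
  \<comment> \<open>\<open>K\<close> is the right-hand side for \<open>i = 0\<close> divided by
    \<open>P\<close>. Since \<open>P - X = P * (1 - X * Q)\<close>, all powers of \<open>P\<close>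
    cancel and \<open>K * (1 - X * Q)^(-(i + 1))\<close> remains.\<close>
  define K where "K = fps_const (1 / (1 - p)) * (fps_binomial (- 1) - fps_const p)"
  have a: "a \<noteq> 0" using p by (simp add: a_def)
  have PQ: "P * Q = 1"
  proof -
    have "P * Q = (fps_const a * fps_const (1 / a)) *
        (fps_binomial (real (Suc k)) * fps_binomial (- real (Suc k)))"
      by (simp only: P_def Q_def fps_binomial_of_nat mult_ac)
    also have "\<dots> = 1" using a by (simp flip: fps_binomial_add_mult)
    finally show ?thesis .
  qed
  define A where "A = Abs_fps (\<lambda>n. real (n + i choose i))"
  \<comment> \<open>Substituting \<open>fps_X * Q\<close> for \<open>fps_X\<close> respects products
    because it has no constant term.\<close>
  have "((1 - fps_X) ^ Suc i * A) oo (fps_X * Q) = 1"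
    unfolding A_def negative_binomial_fps by simp
  then have comp: "(1 - fps_X * Q) ^ Suc i * (A oo (fps_X * Q)) = 1"
    by (simp add: fps_compose_mult_distrib fps_compose_sub_distrib fps_compose_power[symmetric] del: power_Suc)
  define D where "D = P - (fps_X :: real fps)"
  have D0: "D ^ Suc i \<noteq> 0"
  proof -
    have "D $ 0 \<noteq> 0" using a by (simp add: D_def P_def fps_nth_power_0)
    then show ?thesis by auto
  qed
  have DQ: "D = P * (1 - fps_X * Q)"
    using PQ by (simp add: D_def algebra_simps)
  have KP: "K * P = (fps_const p * (1 + fps_X)) ^ k * (1 - fps_const p * (1 + fps_X))"
  proof -
    have "fps_binomial (- 1) * fps_binomial 1 = (1 :: real fps)"
      by (simp flip: fps_binomial_add_mult)
    then have inv: "fps_binomial (- 1) * (1 + fps_X) = (1 :: real fps)" by (simp only: fps_binomial_1)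
    have "K * P = (fps_const (1 / (1 - p)) * fps_const a) * (1 + fps_X) ^ k *
        (fps_binomial (- 1) * (1 + fps_X) - fps_const p * (1 + fps_X))"
      unfolding K_def P_def by (simp only: algebra_simps power_Suc)
    also have "fps_const (1 / (1 - p)) * fps_const a = fps_const (p ^ k)" using p by (simp add: a_def)
    finally show ?thesis by (simp add: inv power_mult_distrib fps_const_power)
  qed
  have "D ^ Suc i * (K * (A oo (fps_X * Q))) =
      P ^ Suc i * K * ((1 - fps_X * Q) ^ Suc i * (A oo (fps_X * Q)))"
    by (simp only: DQ power_mult_distrib mult_ac)
  also have "\<dots> = P ^ i * (K * P)" unfolding comp by (simp add: mult_ac)
  also have "\<dots> = D ^ Suc i * binomial_moment k 0 p (i, 0)"
    using binomial_moment_equation[OF p k, of i 0, folded a_def, folded P_def, folded D_def]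
    unfolding KP by (simp only: power_0 mult_1_right mult.assoc)
  finally have sol: "binomial_moment k 0 p (i, 0) = K * (A oo (fps_X * Q))"
    using D0 by (metis mult_left_cancel)
  have KQ: "K * Q ^ n = fps_const (1 / ((1 - p) * a ^ n)) *
      (fps_binomial (- real (Suc k * n + 1)) - fps_const p * fps_binomial (- real (Suc k * n)))" for n
  proof -
    have "Q ^ n = fps_const (1 / a ^ n) * fps_binomial (- real (Suc k * n))"
      by (simp add: Q_def power_mult_distrib fps_const_power fps_binomial_power power_one_over algebra_simps)
    then have "K * Q ^ n = (fps_const (1 / (1 - p)) * fps_const (1 / a ^ n)) *
        (fps_binomial (- 1) * fps_binomial (- real (Suc k * n)) - fps_const p * fps_binomial (- real (Suc k * n)))"
      unfolding K_def by (simp only: algebra_simps)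
    then show ?thesis by (simp add: algebra_simps flip: fps_binomial_add_mult)
  qed
  have "(K * (A oo (fps_X * Q))) $ s =
      (\<Sum>j=0..s. \<Sum>n=0..s - j. K $ j * (A $ n * (fps_X * Q) ^ n $ (s - j)))"
    by (simp add: fps_mult_nth fps_compose_nth sum_distrib_left)
  \<comment> \<open>The added terms have \<open>n > s - j\<close> and vanish, since
    \<open>(fps_X * Q) ^ n\<close> is divisible by \<open>fps_X ^ n\<close>. The ranges become
    independent and the sums can be swapped.\<close>
  also have "\<dots> = (\<Sum>j=0..s. \<Sum>n=0..s. K $ j * (A $ n * (fps_X * Q) ^ n $ (s - j)))"
    by (intro sum.cong sum.mono_neutral_left) (auto simp: power_mult_distrib fps_X_power_mult_nth)
  also have "\<dots> = (\<Sum>n=0..s. A $ n * (K * (fps_X * Q) ^ n) $ s)"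
    by (subst sum.swap) (simp add: fps_mult_nth sum_distrib_left mult_ac)
  also have "\<dots> = (\<Sum>n=0..s. A $ n * (fps_X ^ n * (K * Q ^ n)) $ s)"
    by (simp add: power_mult_distrib mult_ac)
  also have "\<dots> = (\<Sum>n\<le>s. real (n + i choose i) * (K * Q ^ n) $ (s - n))"
    unfolding atMost_atLeast0 by (intro sum.cong) (auto simp: fps_X_power_mult_nth A_def)
  finally show ?thesis unfolding sol KQ a_def by simp
qed

subsection \<open>From hitting times to success runs\<close>

text \<open>A criterion that inspects only trials \<open>Suc m\<close> to \<open>Suc b\<close>,
  which is what a left-to-right scan can know. Earlier runs are excluded through windows of length
  \<open>k\<close>: any run of length at least \<open>k\<close> contains the window at its
  start.\<close>

lemma first_runI:
  assumes k: "1 \<le> k" and a: "m < a" and len: "a + k \<le> Suc b"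
    and succ: "\<forall>i\<in>{a..b}. x i" and right: "\<not> x (Suc b)"
    and left: "a = Suc m \<or> \<not> x (a - 1)"
    and first: "\<forall>a'. m < a' \<and> a' < a \<longrightarrow> (\<exists>i\<in>{a'..<a' + k}. \<not> x i)"
  shows "first_run k x m a b"
proof -
  have "a' = a \<and> b' = b" if "success_interval x m a' b'" "{a..b} \<subseteq> {a'..b'}" for a' b'
  proof -
    have le: "a' \<le> a" "b \<le> b'" using that(2) len k by auto
    have S: "m < a'" "\<forall>i\<in>{a'..b'}. x i" using that(1) by (auto simp: success_interval_def)
    have "\<not> b < b'" using S(2) right le len k by auto
    moreover have "\<not> a' < a"
    proof
      assume "a' < a"
      then have "a - 1 \<in> {a'..b'}" "a \<noteq> Suc m" using le S(1) len k by auto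
      with S(2) left show False by blast
    qed
    ultimately show ?thesis using le by linarith
  qed
  then have max: "maximal_run x m a b"
    using a succ len k by (auto simp: maximal_run_def success_interval_def)
  have "a \<le> a'" if "maximal_run x m a' b'" "k \<le> card {a'..b'}" for a' b'
  proof (rule ccontr)
    assume "\<not> a \<le> a'"
    moreover have S: "m < a'" "\<forall>i\<in>{a'..b'}. x i"
      using that(1) by (auto simp: maximal_run_def success_interval_def)
    ultimately obtain i where "i \<in> {a'..<a' + k}" "\<not> x i" using first by auto
    moreover have "{a'..<a' + k} \<subseteq> {a'..b'}" using that(2) by auto
    ultimately show False using S(2) by blast
  qed
  with max len show ?thesis by (auto simp: first_run_def)
qed

text \<open>Minimality fixes the left end; intervals with a common left end are nested, so
  maximality fixes the right end.\<close>

lemma first_run_unique: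
  assumes "first_run k x m a b" "first_run k x m a' b'"
  shows "a = a' \<and> b = b'"
proof -
  have a: "a = a'" using assms by (auto simp: first_run_def intro: antisym)
  have M: "maximal_run x m a b" "maximal_run x m a b'"
    using assms a by (auto simp: first_run_def)
  have "{a..b} \<subseteq> {a..b'} \<or> {a..b'} \<subseteq> {a..b}" by auto
  then have "{a..b} = {a..b'}" using M unfolding maximal_run_def by blast
  moreover have "a \<le> b" "a \<le> b'" using M by (auto simp: maximal_run_def success_interval_def)
  ultimately show ?thesis using a by auto
qed

lemma success_run_0: "\<not> success_run k g x 0 a b"
  by (auto elim: success_run.cases)

lemma success_run_unique:
  assumes "success_run k g x j a b" "success_run k g x j a' b'"
  shows "a = a' \<and> b = b'"
  using assms
proof (induction arbitrary: a' b' rule: success_run.induct)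
  case (first a b)
  from first(2) show ?case
    by cases (use first(1) in \<open>auto simp: success_run_0 dest: first_run_unique\<close>)
next
  case (later j a m a1 b1)
  from later.prems show ?case
  proof cases
    case first
    then show ?thesis using later.hyps by (auto simp: success_run_0)
  next
    case (later a'' m'')
    with \<open>first_run k x (m + g) a1 b1\<close> \<open>\<And>a' b'. success_run k g x j a' b' \<Longrightarrow> a = a' \<and> m = b'\<close>
    show ?thesis by (metis first_run_unique)
  qed
qed

lemma waiting_time_eq:
  assumes "success_run k g x r a b"
  shows "waiting_time k g r x = a + k - 1"
proof -
  have "(THE n. \<exists>a b. success_run k g x r a b \<and> n = a + k - 1) = a + k - 1"
  proof (rule the_equality)
    show "\<exists>a' b. success_run k g x r a' b \<and> a + k - 1 = a' + k - 1" using assms by blast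
  next
    fix n assume "\<exists>a b. success_run k g x r a b \<and> n = a + k - 1"
    with assms show "n = a + k - 1" by (auto dest: success_run_unique)
  qed
  with assms show ?thesis by (auto simp: waiting_time_def)
qed

section \<open>The automaton follows the search for runs\<close>

text \<open>The search for run number \<open>j + 1\<close> begins after trial \<open>m\<close>.\<close>

definition run_search :: "nat \<Rightarrow> nat \<Rightarrow> (nat \<Rightarrow> bool) \<Rightarrow> nat \<Rightarrow> nat \<Rightarrow> bool" where
  "run_search k g x j m \<longleftrightarrow> j = 0 \<and> m = 0 \<or> (\<exists>a b. success_run k g x j a b \<and> m = b + g)"

lemma run_search_first_run:
  assumes "run_search k g x j m" "first_run k x m a b"
  shows "success_run k g x (Suc j) a b"
  using assms by (auto simp: run_search_def intro: success_run.later success_run.first[unfolded One_nat_def])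

text \<open>\<open>j\<close> runs have been completed by trial \<open>t\<close>; \<open>a\<close> is where the current streak begins, and
  \<open>a = t + 1\<close> if there is none.\<close>

definition state_inv :: "nat \<Rightarrow> nat \<Rightarrow> (nat \<Rightarrow> bool) \<Rightarrow> nat \<Rightarrow> nat \<Rightarrow> nat \<times> nat \<Rightarrow> bool" where
  "state_inv k G x j t st = (case st of (i, c) \<Rightarrow>
     if c < G then \<exists>a b. success_run k (Suc G) x j a b \<and> t = b + 1 + c
     else c \<le> G + k \<and> (\<exists>m a. run_search k (Suc G) x j m \<and> m < a \<and> (\<forall>i\<in>{a..t}. x i) \<and>
       (a = Suc m \<or> \<not> x (a - 1)) \<and>
       (\<forall>a'. m < a' \<and> a' < a \<longrightarrow> (\<exists>i\<in>{a'..<a' + k}. \<not> x i)) \<and>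
       (c < G + k \<longrightarrow> Suc t = a + (c - G)) \<and>
       (c = G + k \<longrightarrow> a + k \<le> Suc t \<and> (i = 0 \<longrightarrow> Suc t = a + k))))"

lemma state_invI:
  assumes "G \<le> c" "c \<le> G + k" "run_search k (Suc G) x j m" "m < a" "\<forall>i\<in>{a..t}. x i"
    "a = Suc m \<or> \<not> x (a - 1)"
    "\<forall>a'. m < a' \<and> a' < a \<longrightarrow> (\<exists>i\<in>{a'..<a' + k}. \<not> x i)"
    "c < G + k \<Longrightarrow> Suc t = a + (c - G)"
    "c = G + k \<Longrightarrow> a + k \<le> Suc t \<and> (i = 0 \<longrightarrow> Suc t = a + k)"
  shows "state_inv k G x j t (i, c)"
proof -
  have *: "run_search k (Suc G) x j m \<and> m < a \<and> (\<forall>i\<in>{a..t}. x i) \<and>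
       (a = Suc m \<or> \<not> x (a - 1)) \<and>
       (\<forall>a'. m < a' \<and> a' < a \<longrightarrow> (\<exists>i\<in>{a'..<a' + k}. \<not> x i)) \<and>
       (c < G + k \<longrightarrow> Suc t = a + (c - G)) \<and>
       (c = G + k \<longrightarrow> a + k \<le> Suc t \<and> (i = 0 \<longrightarrow> Suc t = a + k))"
    using assms by blast
  have nl: "\<not> c < G" using assms(1) by simp
  show ?thesis
    unfolding state_inv_def prod.case if_not_P[OF nl] by (intro conjI[OF assms(2)] exI, rule *)
qed

lemma state_inv_start:
  assumes "run_search k (Suc G) x j t" "1 \<le> k"
  shows "state_inv k G x j t (i, G)"
  by (rule state_invI[of G G k x j t "Suc t"]) (use assms in auto)

text \<open>The conserved quantity is \<open>i + j\<close>, runs still required plus runs completed;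
  at the target it identifies the index of the run in progress.\<close>

lemma state_inv_step:
  assumes k: "1 \<le> k" and inv: "state_inv k G x j t (i, c)" and nf: "(i, c) \<noteq> (0, G + k)"
  obtains j' i' c' where "run_step k G (i, c) (x (Suc t)) = (i', c')" "i' + j' = i + j"
    "state_inv k G x j' (Suc t) (i', c')"
proof -
  consider "c < G" | "G \<le> c" "c < G + k" "x (Suc t)" | "G \<le> c" "c < G + k" "\<not> x (Suc t)"
    | "c = G + k" "x (Suc t)" | "c = G + k" "\<not> x (Suc t)"
    using inv by (fastforce simp: state_inv_def split: if_splits)
  then show ?thesis
  proof cases
    case 1
    then obtain a b where ab: "success_run k (Suc G) x j a b" "t = b + 1 + c"
      using inv by (auto simp: state_inv_def)
    have "state_inv k G x j (Suc t) (i, Suc c)"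
    proof (cases "Suc c < G")
      case True
      with ab show ?thesis by (auto simp: state_inv_def)
    next
      case False
      with 1 have c: "Suc c = G" by simp
      with ab have "run_search k (Suc G) x j (Suc t)" by (auto simp: run_search_def)
      with c state_inv_start[OF _ k] show ?thesis by simp
    qed
    with 1 show ?thesis by (intro that[of i "Suc c" j]) (auto simp: run_step_def)
  next
    case 2
    then obtain m a where ma: "run_search k (Suc G) x j m" "m < a" "\<forall>i\<in>{a..t}. x i"
      "a = Suc m \<or> \<not> x (a - 1)" "\<forall>a'. m < a' \<and> a' < a \<longrightarrow> (\<exists>i\<in>{a'..<a' + k}. \<not> x i)"
      "Suc t = a + (c - G)"
      using inv by (auto simp: state_inv_def)
    have "\<forall>i\<in>{a..Suc t}. x i" using ma(3) 2 by (auto simp: le_Suc_eq)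
    then have "state_inv k G x j (Suc t) (i, Suc c)"
      by (intro state_invI[of G "Suc c" k x j m a]) (use ma 2 in auto)
    with 2 show ?thesis by (intro that[of i "Suc c" j]) (auto simp: run_step_def)
  next
    case 3
    then obtain m a where ma: "run_search k (Suc G) x j m" "m < a" "\<forall>i\<in>{a..t}. x i"
      "a = Suc m \<or> \<not> x (a - 1)" "\<forall>a'. m < a' \<and> a' < a \<longrightarrow> (\<exists>i\<in>{a'..<a' + k}. \<not> x i)"
      "Suc t = a + (c - G)"
      using inv by (auto simp: state_inv_def)
    \<comment> \<open>The broken streak is shorter than \<open>k\<close>, so every window starting
      inside it or at \<open>Suc t\<close> contains the failure at \<open>Suc t\<close>.\<close>
    have "\<exists>i\<in>{a'..<a' + k}. \<not> x i" if "m < a'" "a' < Suc (Suc t)" for a'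
    proof (cases "a' < a")
      case True
      with ma(5) that show ?thesis by blast
    next
      case False
      then have "Suc t \<in> {a'..<a' + k}" using that ma(6) 3 by auto
      with 3 show ?thesis by blast
    qed
    then have "state_inv k G x j (Suc t) (i, G)"
      by (intro state_invI[of G G k x j m "Suc (Suc t)"]) (use ma 3 k in auto)
    with 3 show ?thesis by (intro that[of i G j]) (auto simp: run_step_def)
  next
    case 4
    then obtain m a where ma: "run_search k (Suc G) x j m" "m < a" "\<forall>i\<in>{a..t}. x i"
      "a = Suc m \<or> \<not> x (a - 1)" "\<forall>a'. m < a' \<and> a' < a \<longrightarrow> (\<exists>i\<in>{a'..<a' + k}. \<not> x i)"
      "a + k \<le> Suc t"
      using inv k by (auto simp: state_inv_def)
    have "\<forall>i\<in>{a..Suc t}. x i" using ma(3) 4 by (auto simp: le_Suc_eq)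
    \<comment> \<open>The equality demanded for \<open>i = 0\<close> is vacuous here: that state is
      the target, excluded by \<open>nf\<close>.\<close>
    then have "state_inv k G x j (Suc t) (i, c)"
      by (intro state_invI[of G c k x j m a]) (use ma 4 nf in auto)
    with 4 show ?thesis by (intro that[of i c j]) (auto simp: run_step_def)
  next
    case 5
    then obtain m a where ma: "run_search k (Suc G) x j m" "m < a" "\<forall>i\<in>{a..t}. x i"
      "a = Suc m \<or> \<not> x (a - 1)" "\<forall>a'. m < a' \<and> a' < a \<longrightarrow> (\<exists>i\<in>{a'..<a' + k}. \<not> x i)"
      "a + k \<le> Suc t"
      using inv k by (auto simp: state_inv_def)
    have run: "success_run k (Suc G) x (Suc j) a t"
      by (rule run_search_first_run[OF ma(1)], rule first_runI) (use ma k 5 in auto)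
    \<comment> \<open>For \<open>G = 0\<close> the counter value 0 already means searching, because
      the closing failure exhausts the gap.\<close>
    have "state_inv k G x (Suc j) (Suc t) (i - 1, 0)"
    proof (cases "G = 0")
      case True
      then have "run_search k (Suc G) x (Suc j) (Suc t)" using run by (auto simp: run_search_def)
      with True state_inv_start[OF _ k] show ?thesis by fastforce
    next
      case False
      with run show ?thesis by (auto simp: state_inv_def)
    qed
    with 5 nf show ?thesis by (intro that[of "i - 1" 0 "Suc j"]) (auto simp: run_step_def)
  qed
qed

text \<open>The event whose probability is \<open>hit_prob\<close>, given the same first-step
  recursion so that one induction matches them.\<close>

primrec hits_at :: "nat \<Rightarrow> nat \<Rightarrow> nat \<Rightarrow> nat \<times> nat \<Rightarrow> bool stream \<Rightarrow> bool" where
  "hits_at k G 0 st \<omega> = (st = (0, G + k))"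
| "hits_at k G (Suc n) st \<omega> =
     (st \<noteq> (0, G + k) \<and> hits_at k G n (run_step k G st (shd \<omega>)) (stl \<omega>))"

text \<open>The target is reached when the last run has exactly \<open>k\<close> successes, before
  its end is known; \<open>inf\<close> supplies the failure that closes it.\<close>

lemma hits_at_success_run:
  assumes k: "1 \<le> k" and inf: "\<And>t. \<exists>i\<ge>t. \<not> x i"
    and hit: "hits_at k G n (i, c) \<omega>" and \<omega>: "\<And>d. x (Suc (t + d)) = \<omega> !! d"
    and inv: "state_inv k G x j t (i, c)"
  shows "\<exists>a b. success_run k (Suc G) x (Suc (i + j)) a b \<and> a + k - 1 = t + n"
  using hit \<omega> inv
proof (induction n arbitrary: i c j t \<omega>)
  case 0
  then have ic: "i = 0" "c = G + k" by auto
  from 0(3) obtain m a where ma: "run_search k (Suc G) x j m" "m < a" "\<forall>i\<in>{a..t}. x i"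
      "a = Suc m \<or> \<not> x (a - 1)" "\<forall>a'. m < a' \<and> a' < a \<longrightarrow> (\<exists>i\<in>{a'..<a' + k}. \<not> x i)"
      "Suc t = a + k"
    using ic k by (auto simp: state_inv_def)
  \<comment> \<open>The first failure after \<open>t\<close>: the run that has just reached length
    \<open>k\<close> ends at \<open>e - 1\<close>.\<close>
  define e where "e = (LEAST e. t < e \<and> \<not> x e)"
  have "\<exists>e. t < e \<and> \<not> x e" using inf[of "Suc t"] by (auto simp: Suc_le_eq)
  then have e: "t < e \<and> \<not> x e" unfolding e_def by (rule LeastI_ex)
  have "x u" if "t < u" "u < e" for u
    using not_less_Least[of u "\<lambda>e. t < e \<and> \<not> x e"] that by (auto simp: e_def)
  then have "\<forall>i\<in>{a..e - 1}. x i"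
    using ma(3) e by (metis atLeastAtMost_iff diff_Suc_1 less_Suc_eq_le less_imp_Suc_add not_less)
  then have "first_run k x m a (e - 1)"
    by (intro first_runI[OF k ma(2)]) (use ma e in auto)
  with ma(1) have "success_run k (Suc G) x (Suc j) a (e - 1)" by (rule run_search_first_run)
  with ma(6) ic show ?case by auto
next
  case (Suc n)
  have nf: "(i, c) \<noteq> (0, G + k)" and next_hit: "hits_at k G n (run_step k G (i, c) (shd \<omega>)) (stl \<omega>)"
    using Suc.prems(1) by auto
  have shd: "shd \<omega> = x (Suc t)" using Suc.prems(2)[of 0] by simp
  obtain j' i' c' where st: "run_step k G (i, c) (x (Suc t)) = (i', c')" "i' + j' = i + j"
    "state_inv k G x j' (Suc t) (i', c')"
    by (rule state_inv_step[OF k Suc.prems(3) nf])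
  have "x (Suc (Suc t + d)) = stl \<omega> !! d" for d using Suc.prems(2)[of "Suc d"] by simp
  from Suc.IH[OF _ this st(3)] next_hit st shd show ?case by simp
qed

lemma hits_at_waiting_time:
  assumes k: "1 \<le> k" and inf: "\<And>t. \<exists>i\<ge>t. \<not> \<omega> !! i" and hit: "hits_at k G n (i, G) \<omega>"
  shows "waiting_time k (Suc G) (Suc i) (\<lambda>i. \<omega> !! (i - 1)) = n"
proof -
  let ?x = "\<lambda>i. \<omega> !! (i - 1)"
  have inf': "\<exists>i\<ge>t. \<not> ?x i" for t
  proof -
    obtain i where "i \<ge> t" "\<not> \<omega> !! i" using inf by blast
    then show ?thesis by (intro exI[of _ "Suc i"]) auto
  qed
  have "state_inv k G ?x 0 0 (i, G)"
    by (rule state_inv_start) (use k in \<open>auto simp: run_search_def\<close>)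
  from hits_at_success_run[OF k inf' hit _ this] obtain a b where
    "success_run k (Suc G) ?x (Suc i) a b" "a + k - 1 = n" by auto
  with waiting_time_eq show ?thesis by blast
qed

subsection \<open>The law of the waiting time\<close>

lemma measurable_first_run [measurable]:
  "Measurable.pred (bernoulli_trials p) (\<lambda>\<omega>. first_run k (\<lambda>i. \<omega> !! (i - 1)) n a b)"
  unfolding first_run_def maximal_run_def success_interval_def bernoulli_trials_def
  by measurable

lemma success_run_1_iff: "success_run k g x (Suc 0) a b \<longleftrightarrow> first_run k x 0 a b"
  by (auto simp: success_run_0 elim: success_run.cases intro: success_run.first[simplified])

lemma success_run_Suc_iff:
  "success_run k g x (Suc (Suc j)) a b \<longleftrightarrow>
    (\<exists>a' m. success_run k g x (Suc j) a' m \<and> first_run k x (m + g) a b)"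
proof
  assume "success_run k g x (Suc (Suc j)) a b"
  then show "\<exists>a' m. success_run k g x (Suc j) a' m \<and> first_run k x (m + g) a b"
    by cases auto
qed (auto intro: success_run.later)

lemma measurable_success_run [measurable]:
  "Measurable.pred (bernoulli_trials p) (\<lambda>\<omega>. success_run k g (\<lambda>i. \<omega> !! (i - 1)) r a b)"
proof (induction r arbitrary: a b)
  case 0
  then show ?case by (simp add: success_run_0)
next
  case (Suc j)
  note Suc[measurable]
  show ?case
  proof (cases j)
    case 0
    then show ?thesis by (simp only: success_run_1_iff measurable_first_run)
  next
    case (Suc j')
    show ?thesis unfolding Suc success_run_Suc_iff unfolding Suc[symmetric] by measurable
  qed
qed

lemma measurable_waiting_time [measurable]:
  "(\<lambda>\<omega>. waiting_time k g r (\<lambda>i. \<omega> !! (i - 1))) \<in> bernoulli_trials p \<rightarrow>\<^sub>M count_space UNIV"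
proof (rule measurable_count_space_eq2_countable[THEN iffD2], safe)
  fix n :: nat
  let ?x = "\<lambda>\<omega> i. \<omega> !! (i - 1) :: bool"
  have "waiting_time k g r x = n \<longleftrightarrow> (\<exists>a b. success_run k g x r a b \<and> n = a + k - 1) \<or>
      (n = 0 \<and> \<not> (\<exists>a b. success_run k g x r a b))" for x
  proof (cases "\<exists>a b. success_run k g x r a b")
    case True
    then obtain a b where "success_run k g x r a b" by blast
    then show ?thesis using waiting_time_eq success_run_unique by (metis (no_types))
  qed (auto simp: waiting_time_def)
  then have "(\<lambda>\<omega>. waiting_time k g r (?x \<omega>)) -` {n} \<inter> space (bernoulli_trials p) =
    {\<omega> \<in> space (bernoulli_trials p). (\<exists>a b. success_run k g (?x \<omega>) r a b \<and> n = a + k - 1) \<or>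
      (n = 0 \<and> \<not> (\<exists>a b. success_run k g (?x \<omega>) r a b))}" by auto
  also have "\<dots> \<in> sets (bernoulli_trials p)" by measurable
  finally show "(\<lambda>\<omega>. waiting_time k g r (?x \<omega>)) -` {n} \<inter> space (bernoulli_trials p)
    \<in> sets (bernoulli_trials p)" .
qed auto

section \<open>Probabilities of the hitting events\<close>

lemma prob_space_bernoulli_trials: "prob_space (bernoulli_trials p)"
  unfolding bernoulli_trials_def by (rule prob_space.prob_space_stream_space[OF prob_space_measure_pmf])

lemma measurable_hits_at [measurable]: "Measurable.pred (bernoulli_trials p) (hits_at k G n st)"
proof (induction n arbitrary: st)
  case (Suc n)
  note Suc[unfolded bernoulli_trials_def, measurable]
  have eq: "hits_at k G (Suc n) st \<omega> \<longleftrightarrow> st \<noteq> (0, G + k) \<and>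
      (if shd \<omega> then hits_at k G n (run_step k G st True) (stl \<omega>)
       else hits_at k G n (run_step k G st False) (stl \<omega>))" for \<omega> by auto
  show ?case unfolding eq[abs_def] bernoulli_trials_def by measurable
qed (simp add: hits_at.simps(1)[abs_def])

lemma emeasure_bernoulli_trials_step:
  assumes p: "0 \<le> p" "p \<le> 1" and P: "Measurable.pred (bernoulli_trials p) P"
  shows "emeasure (bernoulli_trials p) {\<omega>. P \<omega>} =
    emeasure (bernoulli_trials p) {\<omega>. P (True ## \<omega>)} * ennreal p +
    emeasure (bernoulli_trials p) {\<omega>. P (False ## \<omega>)} * ennreal (1 - p)"
proof -
  have sp: "space (stream_space (measure_pmf (bernoulli_pmf p))) = UNIV"
    by (simp add: space_stream_space)
  have "{\<omega>. P \<omega>} \<in> sets (stream_space (measure_pmf (bernoulli_pmf p)))"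
    using P unfolding bernoulli_trials_def pred_def sp by simp
  from prob_space.emeasure_stream_space[OF prob_space_measure_pmf this] show ?thesis
    unfolding bernoulli_trials_def sp using p by simp
qed

lemma emeasure_hits_at:
  assumes p: "0 \<le> p" "p \<le> 1"
  shows "emeasure (bernoulli_trials p) {\<omega>. hits_at k G n st \<omega>} = ennreal (hit_prob k G p n st)"
proof (induction n arbitrary: st)
  case 0
  interpret prob_space "bernoulli_trials p" by (rule prob_space_bernoulli_trials)
  have "space (bernoulli_trials p) = UNIV" by (simp add: bernoulli_trials_def space_stream_space)
  then show ?case using emeasure_space_1 by (cases "st = (0, G + k)") auto
next
  case (Suc n)
  show ?case
    by (subst emeasure_bernoulli_trials_step[OF p measurable_hits_at])
      (use p in \<open>auto simp: Suc hit_prob_nonneg ennreal_mult[symmetric] ennreal_plus[symmetric] mult_ac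
         simp del: ennreal_plus\<close>)
qed

text \<open>Splitting on the first trial, the probability e of the all-success event satisfies e = e
  p, so e = 0. Prepending a trial carries the claim from \<open>t\<close> to
  \<open>Suc t\<close>.\<close>

lemma AE_infinitely_many_failures:
  assumes p: "0 < p" "p < 1"
  shows "AE \<omega> in bernoulli_trials p. \<forall>t. \<exists>i\<ge>t. \<not> \<omega> !! i"
proof -
  interpret prob_space "bernoulli_trials p" by (rule prob_space_bernoulli_trials)
  have sp: "space (bernoulli_trials p) = UNIV" by (simp add: bernoulli_trials_def space_stream_space)
  have M: "Measurable.pred (bernoulli_trials p) (\<lambda>\<omega>. \<exists>i\<ge>t. \<not> \<omega> !! i)" for t
    unfolding bernoulli_trials_def by measurable
  have AE: "AE \<omega> in bernoulli_trials p. \<exists>i\<ge>t. \<not> \<omega> !! i" for t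
  proof (induction t)
    case 0
    have M0: "Measurable.pred (bernoulli_trials p) (\<lambda>\<omega>. \<forall>i. \<omega> !! i)"
      unfolding bernoulli_trials_def by measurable
    have all: "(\<forall>i. (b ## \<omega>) !! i) \<longleftrightarrow> b \<and> (\<forall>i. \<omega> !! i)" for b \<omega>
      by (metis nat.exhaust snth.simps stream.sel)
    let ?e = "prob {\<omega>. \<forall>i. \<omega> !! i}"
    have "ennreal ?e = ennreal ?e * ennreal p"
      using emeasure_bernoulli_trials_step[OF _ _ M0] p unfolding all
      by (simp add: emeasure_eq_measure)
    then have "?e = ?e * p" using p by (simp add: ennreal_mult[symmetric])
    then have "?e = 0" using p by simp
    then have "AE \<omega> in bernoulli_trials p. \<not> (\<forall>i. \<omega> !! i)"
      using M0 sp by (subst AE_iff_measurable[of "{\<omega>. \<forall>i. \<omega> !! i}"])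
        (auto simp: emeasure_eq_measure pred_def)
    then show ?case by simp
  next
    case (Suc t)
    have "AE \<omega> in bernoulli_trials p. \<exists>i\<ge>Suc t. \<not> (b ## \<omega>) !! i" for b
      using Suc
    proof eventually_elim
      case (elim \<omega>)
      then obtain i where "i \<ge> t" "\<not> \<omega> !! i" by blast
      then show ?case by (intro exI[of _ "Suc i"]) auto
    qed
    then have "AE b in measure_pmf (bernoulli_pmf p). AE \<omega> in bernoulli_trials p.
        \<exists>i\<ge>Suc t. \<not> (b ## \<omega>) !! i" by simp
    then show ?case
      unfolding bernoulli_trials_def
      by (subst prob_space.AE_stream_space[OF prob_space_measure_pmf M[unfolded bernoulli_trials_def]])
  qed
  then show ?thesis by (simp add: AE_all_countable)
qed

text \<open>The total hitting probability is the moment of order 0, where the closed form reduces to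
  \<open>(1 - p) / (1 - p)\<close>.\<close>

lemma hit_prob_sums_1:
  assumes p: "0 < p" "p < 1" and k: "1 \<le> k"
  shows "(\<lambda>n. hit_prob k G p n (i, G)) sums 1"
proof -
  have "binomial_moment k G p (i, G) $ 0 = 1"
    using p by (simp add: binomial_moment_shift[OF p k, of G] fps_nth_power_0 binomial_moment_closed_form[OF p k])
  then show ?thesis
    using summable_hit_prob_binomial[OF p, of G G k i 0] by (simp add: binomial_moment_def sums_iff)
qed

lemma emeasure_NB_II:
  assumes p: "0 < p" "p < 1" and k: "1 \<le> k"
  shows "emeasure (NB_II k (Suc G) (Suc i) p) {n} = ennreal (hit_prob k G p n (i, G))"
proof -
  let ?f = "\<lambda>n. hit_prob k G p n (i, G)"
  interpret B: prob_space "bernoulli_trials p" by (rule prob_space_bernoulli_trials)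
  interpret N: prob_space "NB_II k (Suc G) (Suc i) p"
    unfolding NB_II_def by (rule B.prob_space_distr) measurable
  have sp: "space (bernoulli_trials p) = UNIV" by (simp add: bernoulli_trials_def space_stream_space)
  have sets: "sets (NB_II k (Suc G) (Suc i) p) = UNIV" by (simp add: NB_II_def)
  \<comment> \<open>One inequality suffices, since both sides have total mass 1.\<close>
  have le: "?f n \<le> N.prob {n}" for n
  proof -
    have "emeasure (bernoulli_trials p) {\<omega>. hits_at k G n (i, G) \<omega>} \<le>
        emeasure (bernoulli_trials p)
          ((\<lambda>\<omega>. waiting_time k (Suc G) (Suc i) (\<lambda>i. \<omega> !! (i - 1))) -` {n} \<inter> space (bernoulli_trials p))"
    proof (rule emeasure_mono_AE)
      show "AE \<omega> in bernoulli_trials p. \<omega> \<in> {\<omega>. hits_at k G n (i, G) \<omega>} \<longrightarrow>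
          \<omega> \<in> (\<lambda>\<omega>. waiting_time k (Suc G) (Suc i) (\<lambda>i. \<omega> !! (i - 1))) -` {n} \<inter> space (bernoulli_trials p)"
        using AE_infinitely_many_failures[OF p]
        by eventually_elim (auto simp: sp hits_at_waiting_time[OF k, simplified])
      show "(\<lambda>\<omega>. waiting_time k (Suc G) (Suc i) (\<lambda>i. \<omega> !! (i - 1))) -` {n} \<inter> space (bernoulli_trials p)
          \<in> sets (bernoulli_trials p)"
        using measurable_sets[OF measurable_waiting_time] by simp
    qed
    also have "\<dots> = emeasure (NB_II k (Suc G) (Suc i) p) {n}"
      unfolding NB_II_def by (subst emeasure_distr[OF measurable_waiting_time]) auto
    finally show ?thesis
      using p by (simp add: emeasure_hits_at N.emeasure_eq_measure)
  qed
  have "(\<lambda>n. N.prob {n}) sums N.prob (\<Union>n. {n})"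
    by (rule N.finite_measure_UNION) (auto simp: sets disjoint_family_on_def)
  moreover have "(\<Union>n. {n}) = space (NB_II k (Suc G) (Suc i) p)" by (auto simp: NB_II_def)
  ultimately have "(\<lambda>n. N.prob {n}) sums 1" using N.prob_space by metis
  then have "(\<lambda>n. N.prob {n} - ?f n) sums 0"
    using sums_diff[OF _ hit_prob_sums_1[OF p k]] by fastforce
  then have "\<forall>n. N.prob {n} - ?f n = 0"
    using suminf_eq_zero_iff[of "\<lambda>n. N.prob {n} - ?f n"] le by (auto simp: sums_iff)
  then show ?thesis by (simp add: N.emeasure_eq_measure)
qed

lemma NB_II_eq_density:
  assumes p: "0 < p" "p < 1" and k: "1 \<le> k"
  shows "NB_II k (Suc G) (Suc i) p =
    density (count_space UNIV) (\<lambda>n. ennreal (hit_prob k G p n (i, G)))"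
proof (rule measure_eqI_countable[where A = UNIV])
  fix n :: nat
  show "emeasure (NB_II k (Suc G) (Suc i) p) {n} =
      emeasure (density (count_space UNIV) (\<lambda>n. ennreal (hit_prob k G p n (i, G)))) {n}"
    unfolding emeasure_NB_II[OF p k]
    by (subst emeasure_density) (auto simp: nn_integral_count_space_indicator[symmetric]
       nn_integral_count_space_finite)
qed (auto simp: NB_II_def)

lemma falling_factorial_eq_binomial: "falling_factorial (real n) s = fact s * real (n choose s)"
proof -
  have "real n gchoose s = falling_factorial (real n) s / fact s"
    by (simp add: gbinomial_prod_rev falling_factorial_def atLeast0LessThan)
  then show ?thesis by (simp add: binomial_gbinomial)
qed

lemma NB_II_factorial_moment:
  assumes p: "0 < p" "p < 1" and k: "1 \<le> k"
  shows "integrable (NB_II k (Suc G) (Suc i) p) (\<lambda>n. falling_factorial (real n) s)"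
    and "(\<integral>n. falling_factorial (real n) s \<partial>NB_II k (Suc G) (Suc i) p) =
      fact s * binomial_moment k G p (i, G) $ s"
proof -
  let ?f = "\<lambda>n. hit_prob k G p n (i, G)"
  have f: "0 \<le> ?f n" for n using p by (simp add: hit_prob_nonneg)
  have "summable (\<lambda>n. ?f n * real (n choose s))"
    by (rule summable_hit_prob_binomial[OF p]) simp
  then have s: "(\<lambda>n. fact s * (?f n * real (n choose s))) sums (fact s * binomial_moment k G p (i, G) $ s)"
    unfolding binomial_moment_def by (auto intro!: sums_mult simp: summable_sums)
  have eq: "?f n *\<^sub>R falling_factorial (real n) s = fact s * (?f n * real (n choose s))" for n
    by (simp add: falling_factorial_eq_binomial)
  have int: "integrable (count_space UNIV) (\<lambda>n. fact s * (?f n * real (n choose s)))"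
    using s f by (auto simp: integrable_count_space_nat_iff sums_iff abs_mult)
  then show "integrable (NB_II k (Suc G) (Suc i) p) (\<lambda>n. falling_factorial (real n) s)"
    unfolding NB_II_eq_density[OF p k]
    by (subst integrable_density) (auto simp: f eq falling_factorial_eq_binomial mult_ac)
  show "(\<integral>n. falling_factorial (real n) s \<partial>NB_II k (Suc G) (Suc i) p) =
      fact s * binomial_moment k G p (i, G) $ s"
    unfolding NB_II_eq_density[OF p k]
    using integral_count_space_nat[OF int] s
    by (subst integral_density) (auto simp: f eq sums_iff simp del: real_scaleR_def)
qed

subsection \<open>Factorial moments\<close>

lemma falling_factorial_eq_0:
  assumes "c < j"
  shows "falling_factorial (real c) j = 0"
  using assms by (auto simp: falling_factorial_def)

text \<open>The closed form summed backwards, with \<open>j = s - n\<close>; the signs come from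
  upper negation of the binomial coefficients.\<close>

lemma binomial_moment_0_nth:
  fixes p q :: real
  assumes p: "0 < p" "p < 1" and q: "q = 1 - p" and k: "1 \<le> k" and r: "1 \<le> r"
  shows "binomial_moment k 0 p (r - 1, 0) $ s = 1 / (q ^ (s + 1) * p ^ (k * s)) *
       (\<Sum>j=0..s. (-1) ^ j * q ^ j * p ^ (j * k) *
          ((real s - real j + real r - 1) gchoose (r - 1)) *
          (((real ((k + 1) * s) - real (j * k)) gchoose j) -
            p * ((real ((k + 1) * s) - real (j * k) - 1) gchoose j)))"
proof -
  have q0: "0 < q" using p q by simp
  have "binomial_moment k 0 p (r - 1, 0) $ s =
    (\<Sum>n\<le>s. real (n + (r - 1) choose (r - 1)) / (q * (q * p ^ k) ^ n) *
      ((fps_binomial (- real (Suc k * n + 1)) - fps_const p * fps_binomial (- real (Suc k * n))) $ (s - n)))"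
    by (simp only: binomial_moment_closed_form[OF p k] q)
  also have "\<dots> = (\<Sum>j=0..s. real (s - j + (r - 1) choose (r - 1)) / (q * (q * p ^ k) ^ (s - j)) *
      ((fps_binomial (- real (Suc k * (s - j) + 1)) - fps_const p * fps_binomial (- real (Suc k * (s - j)))) $ j))"
    by (rule sum.reindex_bij_witness[of _ "\<lambda>j. s - j" "\<lambda>j. s - j"]) auto
  also have "\<dots> = (\<Sum>j=0..s. 1 / (q ^ (s + 1) * p ^ (k * s)) * ((-1) ^ j * q ^ j * p ^ (j * k) *
          ((real s - real j + real r - 1) gchoose (r - 1)) *
          (((real ((k + 1) * s) - real (j * k)) gchoose j) -
            p * ((real ((k + 1) * s) - real (j * k) - 1) gchoose j))))"
  proof (rule sum.cong[OF refl])
    fix j assume "j \<in> {0..s}"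
    then obtain n where s: "s = n + j" by (metis atLeastAtMost_iff le_add_diff_inverse2)
    have b: "(real s - real j + real r - 1) gchoose (r - 1) = real (n + (r - 1) choose (r - 1))"
      using r s by (simp add: binomial_gbinomial of_nat_diff algebra_simps)
    \<comment> \<open>With \<open>s = n + j\<close>, the negated upper argument is
      \<open>(k + 1) * n + j = (k + 1) * s - j * k\<close>. The subtraction is over the reals, so
      \<open>g2\<close> also covers the upper argument -1 at \<open>s = 0\<close>.\<close>
    have g1: "(- real (Suc k * n + 1)) gchoose j = (-1) ^ j * ((real ((k + 1) * s) - real (j * k)) gchoose j)"
      unfolding gbinomial_minus s by (simp add: algebra_simps)
    have g2: "(- real (Suc k * n)) gchoose j = (-1) ^ j * ((real ((k + 1) * s) - real (j * k) - 1) gchoose j)"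
      unfolding gbinomial_minus s by (simp add: algebra_simps)
    have pow: "q ^ (s + 1) * p ^ (k * s) = q ^ j * p ^ (j * k) * (q * (q * p ^ k) ^ n)"
      by (simp add: s power_add power_mult_distrib algebra_simps flip: power_mult)
    have nz: "q ^ j * p ^ (j * k) \<noteq> 0" "q * (q * p ^ k) ^ n \<noteq> 0" using p q0 by auto
    have "1 / y = 1 / (x * y) * x" if "x \<noteq> 0" "y \<noteq> 0" for x y :: real
      using that by simp
    from this[OF nz] have den: "1 / (q * (q * p ^ k) ^ n) = 1 / (q ^ (s + 1) * p ^ (k * s)) * (q ^ j * p ^ (j * k))"
      unfolding pow .
    show "real (s - j + (r - 1) choose (r - 1)) / (q * (q * p ^ k) ^ (s - j)) *
      ((fps_binomial (- real (Suc k * (s - j) + 1)) - fps_const p * fps_binomial (- real (Suc k * (s - j)))) $ j) =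
      1 / (q ^ (s + 1) * p ^ (k * s)) * ((-1) ^ j * q ^ j * p ^ (j * k) *
          ((real s - real j + real r - 1) gchoose (r - 1)) *
          (((real ((k + 1) * s) - real (j * k)) gchoose j) -
            p * ((real ((k + 1) * s) - real (j * k) - 1) gchoose j)))"
    proof -
      have "real (s - j + (r - 1) choose (r - 1)) / (q * (q * p ^ k) ^ (s - j)) =
          real (n + (r - 1) choose (r - 1)) * (1 / (q ^ (s + 1) * p ^ (k * s)) * (q ^ j * p ^ (j * k)))"
        unfolding den[symmetric] by (simp add: s)
      moreover have "(fps_binomial (- real (Suc k * (s - j) + 1)) -
            fps_const p * fps_binomial (- real (Suc k * (s - j)))) $ j =
          (-1) ^ j * (((real ((k + 1) * s) - real (j * k)) gchoose j) -
            p * ((real ((k + 1) * s) - real (j * k) - 1) gchoose j))"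
      proof -
        have "s - j = n" by (simp add: s)
        then show ?thesis
          by (simp only: fps_sub_nth fps_mult_left_const_nth fps_binomial_nth g1 g2
              right_diff_distrib mult.left_commute)
      qed
      ultimately show ?thesis unfolding b by (simp only: mult_ac)
    qed
  qed
  finally show ?thesis by (simp only: sum_distrib_left)
qed

lemma binomial_moment_shift_factorial:
  assumes p: "0 < p" "p < 1" and k: "1 \<le> k"
  shows "fact s * binomial_moment k G p (i, G) $ s =
    (\<Sum>j=0..min s (i * G). real (s choose j) * falling_factorial (real (i * G)) j *
       (fact (s - j) * binomial_moment k 0 p (i, 0) $ (s - j)))"
proof -
  have X: "(1 + fps_X :: real fps) ^ (G * i) = fps_binomial (real (i * G))"
    by (simp only: fps_binomial_of_nat mult.commute)
  have "fact s * binomial_moment k G p (i, G) $ s =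
      (\<Sum>j=0..s. fact s * (real (i * G choose j) * binomial_moment k 0 p (i, 0) $ (s - j)))"
    by (simp only: binomial_moment_shift[OF p k, of G] X fps_mult_nth fps_binomial_nth
        binomial_gbinomial[symmetric] sum_distrib_left)
  also have "\<dots> = (\<Sum>j=0..s. real (s choose j) * falling_factorial (real (i * G)) j *
       (fact (s - j) * binomial_moment k 0 p (i, 0) $ (s - j)))"
  proof (rule sum.cong[OF refl])
    fix j assume "j \<in> {0..s}"
    \<comment> \<open>The factor \<open>fact j\<close> turns \<open>i * G choose j\<close> into the
      falling factorial, and \<open>fact (s - j)\<close> completes the lower moment.\<close>
    then have "fact s = (fact j * fact (s - j) * real (s choose j) :: real)"
      using binomial_fact_lemma[of j s] by (metis atLeastAtMost_iff of_nat_fact of_nat_mult)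
    then show "fact s * (real (i * G choose j) * binomial_moment k 0 p (i, 0) $ (s - j)) =
        real (s choose j) * falling_factorial (real (i * G)) j *
         (fact (s - j) * binomial_moment k 0 p (i, 0) $ (s - j))"
      by (simp only: falling_factorial_eq_binomial mult_ac)
  qed
  also have "\<dots> = (\<Sum>j=0..min s (i * G). real (s choose j) * falling_factorial (real (i * G)) j *
       (fact (s - j) * binomial_moment k 0 p (i, 0) $ (s - j)))"
    by (rule sum.mono_neutral_right) (auto simp: falling_factorial_eq_0 simp del: of_nat_mult)
  finally show ?thesis .
qed

theorem mainTheorem11:
  fixes k r :: nat and p q :: real
    and M :: "nat \<Rightarrow> 'a measure" and W :: "nat \<Rightarrow> 'a \<Rightarrow> nat"
    and F :: "nat \<Rightarrow> nat \<Rightarrow> real"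
  assumes "k \<ge> 1" and "r \<ge> 1" and "0 < p" and "p < 1" and "q = 1 - p"
    and "\<And>g. g \<ge> 1 \<Longrightarrow> prob_space (M g)"
    and "\<And>g. g \<ge> 1 \<Longrightarrow> W g \<in> measurable (M g) (count_space UNIV)"
    and "\<And>g. g \<ge> 1 \<Longrightarrow> distr (M g) (count_space UNIV) (W g) = NB_II k g r p"
    and "\<And>s g. g \<ge> 1 \<Longrightarrow> F s g = factorial_moment (M g) (W g) s"
  shows "(\<forall>g\<ge>1. \<forall>s. integrable (M g) (\<lambda>\<omega>. falling_factorial (real (W g \<omega>)) s)) \<and>
    (\<forall>s. F s 1 = fact s / (q ^ (s + 1) * p ^ (k * s)) *
       (\<Sum>j=0..s. (-1) ^ j * q ^ j * p ^ (j * k) *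
          ((real s - real j + real r - 1) gchoose (r - 1)) *
          (((real ((k + 1) * s) - real (j * k)) gchoose j) -
            p * ((real ((k + 1) * s) - real (j * k) - 1) gchoose j)))) \<and>
    (\<forall>g>1. \<forall>s. F s g =
       (\<Sum>j=0..min s ((r - 1) * (g - 1)).
          real (s choose j) * falling_factorial (real ((r - 1) * (g - 1))) j * F (s - j) 1))"
proof (intro conjI allI impI)
  note k = assms(1) and r = assms(2) and p = assms(3,4) and q = assms(5)
  have law: "distr (M g) (count_space UNIV) (W g) = NB_II k (Suc (g - 1)) (Suc (r - 1)) p" if "g \<ge> 1" for g
    using assms(8)[OF that] r that by simp
  show "integrable (M g) (\<lambda>\<omega>. falling_factorial (real (W g \<omega>)) s)" if "1 \<le> g" for g s
    by (rule integrable_distr[OF assms(7)[OF that]]) (simp only: law[OF that] NB_II_factorial_moment[OF p k])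
  have F: "F s g = fact s * binomial_moment k (g - 1) p (r - 1, g - 1) $ s" if "1 \<le> g" for s g
  proof -
    have "F s g = (\<integral>n. falling_factorial (real n) s \<partial>distr (M g) (count_space UNIV) (W g))"
      by (subst integral_distr[OF assms(7)[OF that]]) (simp_all add: assms(9)[OF that] factorial_moment_def)
    then show ?thesis by (simp only: law[OF that] NB_II_factorial_moment[OF p k])
  qed
  have F1: "F s 1 = fact s * binomial_moment k 0 p (r - 1, 0) $ s" for s
    using F[of 1 s] by simp
  show "F s 1 = fact s / (q ^ (s + 1) * p ^ (k * s)) *
       (\<Sum>j=0..s. (-1) ^ j * q ^ j * p ^ (j * k) *
          ((real s - real j + real r - 1) gchoose (r - 1)) *
          (((real ((k + 1) * s) - real (j * k)) gchoose j) -
            p * ((real ((k + 1) * s) - real (j * k) - 1) gchoose j)))" for s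
    unfolding F1 binomial_moment_0_nth[OF p q k r] by (simp only: mult.assoc[symmetric] times_divide_eq_right mult_1_right)
  show "F s g = (\<Sum>j=0..min s ((r - 1) * (g - 1)).
          real (s choose j) * falling_factorial (real ((r - 1) * (g - 1))) j * F (s - j) 1)"
    if "1 < g" for g s
    unfolding F1 F[OF less_imp_le[OF that]] by (rule binomial_moment_shift_factorial[OF p k])
qed

end
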